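(* Let $(W,S)$ be a finite Coxeter system, $Q=q_1\cdots q_m$ a word on $S$, and $\rho\in W$. Let $I\neq\mathsf P(Q,\rho)$ be a facet of $\mathcal{SC}(Q,\rho)$. Define $y$ to be the largest position in $[m]$ such that $$\{i-y+1 : i\in I,\ i\ge y\}\ne\mathsf P\big(q_y\cdots q_m,\ \Pi Q_{[y,m]\setminus I}\big),$$ and $x$ to be the largest position in $I$ such that $\mathsf r(I,x)=-\mathsf r(I,y)$. Then the father of $I$ in the positive source tree $\mathcal P(Q,\rho)$ is obtained from $I$ by flipping $x$.
   Context: Let $(W,S)$ be a finite Coxeter system acting by reflections on a Euclidean space $V$, with length function $\ell$, root system $\Phi=\Phi^+\sqcup\Phi^-$ and simple roots $\{\alpha_s: s\in S\}$. For a word $Q=q_1q_2\cdots q_m$ in the letters $S$ and $\rho\in W$, write $[m]=\{1,\dots,m\}$, $[y,m]=\{y,\dots,m\}$, and for $X\subseteq[m]$ let $\Pi Q_X\in W$ be the product of the reflections $q_x$, $x\in X$, in increasing order of position. The subword complex $\mathcal{SC}(Q,\rho)$ is the simplicial complex whose facets are the sets $I\subseteq[m]$ such that the letters of $Q$ at the positions in $[m]\setminus I$, read in increasing order of position, form a reduced expression of $\rho$. Positions in any word are numbered from $1$. The root function of a facet $I$ is $\mathsf r(I,k)=\Pi Q_{[k-1]\setminus I}(\alpha_{q_k})\in\Phi$ for $k\in[m]$. Two distinct facets $I,J$ are adjacent if $I\setminus\{i\}=J\setminus\{j\}$ for some $i\in I$, $j\in J$; then $J$ is obtained from $I$ by flipping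 $i$ (given $I$ and $i$, the facet $J\ne I$ is unique if it exists). The flip is increasing if $i<j$. The increasing flip graph $\mathcal G(Q,\rho)$ is the directed graph whose vertices are the facets and whose edges $I\to J$ are the increasing flips. For an edge $I\to J$ with $I\setminus\{i\}=J\setminus\{j\}$, $i<j$, set $\mathsf p(I\to J)=i$. A path is $\mathsf p$-rising if the sequence of $\mathsf p$-labels of its successive edges is strictly increasing. When $\mathcal{SC}(Q,\rho)$ is non-empty, the positive greedy facet $\mathsf P(Q,\rho)$ is the unique source of $\mathcal G(Q,\rho)$ (equivalently the lexicographically smallest facet). The positive source tree $\mathcal P(Q,\rho)$ is the spanning tree of $\mathcal G(Q,\rho)$, rooted at $\mathsf P(Q,\rho)$, formed by all $\mathsf p$-rising paths from $\mathsf P(Q,\rho)$ to the facets (there is exactly one to each facet); the father of $I\neq\mathsf P(Q,\rho)$ is the facet preceding $I$ on the $\mathsf p$-rising path from $\mathsf P(Q,\rho)$ to $I$. *)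

theory Defs
  imports "HOL-Analysis.Analysis"
begin

section \<open>Finite Coxeter systems acting on a Euclidean space\<close>

definition reflection :: "'v::euclidean_space \<Rightarrow> 'v \<Rightarrow> 'v" where
  "reflection v x = x - (2 * (x \<bullet> v) / (v \<bullet> v)) *\<^sub>R v"

(* Group elements are maps acting from the left, so that the product of the
   word s1 s2 ... sp is the composition applying sp first. *)
definition word_prod :: "('v \<Rightarrow> 'v) list \<Rightarrow> 'v \<Rightarrow> 'v" where
  "word_prod ss = foldr (\<circ>) ss id"

(* alpha s is the simple root of the simple reflection s. *)
definition positive_roots ::
  "('v::euclidean_space \<Rightarrow> 'v) set \<Rightarrow> 'v set \<Rightarrow> (('v \<Rightarrow> 'v) \<Rightarrow> 'v) \<Rightarrow> 'v set" where
  "positive_roots S \<Phi> \<alpha> =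
     {\<beta> \<in> \<Phi>. \<exists>c. (\<forall>s\<in>S. (c s :: real) \<ge> 0) \<and> \<beta> = (\<Sum>s\<in>S. c s *\<^sub>R \<alpha> s)}"

(* A finite Coxeter system is realised as a finite reflection group W with its set S of
   simple reflections, with respect to a root system for W (reduced, not necessarily
   crystallographic, and not necessarily spanning the space) and a simple system in it.
   By the axioms alpha is injective on S with linearly independent image, so S is
   finite and the sums in positive_roots are genuine. *)
locale finite_coxeter_system =
  fixes W :: "('v::euclidean_space \<Rightarrow> 'v) set"
    and S :: "('v \<Rightarrow> 'v) set"
    and \<Phi> :: "'v set"
    and \<alpha> :: "('v \<Rightarrow> 'v) \<Rightarrow> 'v"
  assumes finite_group: "finite W"
    and generated: "W = word_prod ` lists S"
    and root_nonzero: "\<beta> \<in> \<Phi> \<Longrightarrow> \<beta> \<noteq> 0"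
    and root_reflection: "\<beta> \<in> \<Phi> \<Longrightarrow> reflection \<beta> \<in> W"
    and roots_stable: "w \<in> W \<Longrightarrow> w ` \<Phi> = \<Phi>"
    and root_line: "\<beta> \<in> \<Phi> \<Longrightarrow> \<Phi> \<inter> span {\<beta>} = {\<beta>, - \<beta>}"
    and simple_root: "s \<in> S \<Longrightarrow> \<alpha> s \<in> \<Phi>"
    and simple_reflection: "s \<in> S \<Longrightarrow> s = reflection (\<alpha> s)"
    and simple_independent: "independent (\<alpha> ` S)"
    and root_decomposition: "\<Phi> = positive_roots S \<Phi> \<alpha> \<union> uminus ` positive_roots S \<Phi> \<alpha>"

definition coxeter_length :: "('v \<Rightarrow> 'v) set \<Rightarrow> ('v \<Rightarrow> 'v) \<Rightarrow> nat" where
  "coxeter_length S w = (LEAST n. \<exists>ss\<in>lists S. length ss = n \<and> word_prod ss = w)"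

definition reduced_expression :: "('v \<Rightarrow> 'v) set \<Rightarrow> ('v \<Rightarrow> 'v) \<Rightarrow> ('v \<Rightarrow> 'v) list \<Rightarrow> bool" where
  "reduced_expression S \<rho> ss \<longleftrightarrow>
     ss \<in> lists S \<and> word_prod ss = \<rho> \<and> length ss = coxeter_length S \<rho>"

section \<open>Subword complexes\<close>

(* Positions in a word are numbered from 1, whereas list indices start at 0. *)
definition letter :: "'a list \<Rightarrow> nat \<Rightarrow> 'a" where
  "letter Q k = Q ! (k - 1)"

definition subword :: "'a list \<Rightarrow> nat set \<Rightarrow> 'a list" where
  "subword Q X = nths Q {k. Suc k \<in> X}"

definition subword_prod :: "('v \<Rightarrow> 'v) list \<Rightarrow> nat set \<Rightarrow> 'v \<Rightarrow> 'v" where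
  "subword_prod Q X = word_prod (subword Q X)"

(* The facets of the subword complex SC(Q, rho), which determine it. *)
definition facets :: "('v \<Rightarrow> 'v) set \<Rightarrow> ('v \<Rightarrow> 'v) list \<Rightarrow> ('v \<Rightarrow> 'v) \<Rightarrow> nat set set" where
  "facets S Q \<rho> =
     {I. I \<subseteq> {1..length Q} \<and> reduced_expression S \<rho> (subword Q ({1..length Q} - I))}"

definition root_function ::
  "(('v \<Rightarrow> 'v) \<Rightarrow> 'v) \<Rightarrow> ('v \<Rightarrow> 'v) list \<Rightarrow> nat set \<Rightarrow> nat \<Rightarrow> 'v" where
  "root_function \<alpha> Q I k = subword_prod Q ({1..<k} - I) (\<alpha> (letter Q k))"

definition is_flip ::
  "('v \<Rightarrow> 'v) set \<Rightarrow> ('v \<Rightarrow> 'v) list \<Rightarrow> ('v \<Rightarrow> 'v) \<Rightarrow> nat set \<Rightarrow> nat \<Rightarrow> nat set \<Rightarrow> bool" where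
  "is_flip S Q \<rho> I i J \<longleftrightarrow>
     I \<in> facets S Q \<rho> \<and> J \<in> facets S Q \<rho> \<and> I \<noteq> J \<and> i \<in> I \<and> (\<exists>j\<in>J. I - {i} = J - {j})"

section \<open>The increasing flip graph and its positive source tree\<close>

definition increasing_flip_graph ::
  "('v \<Rightarrow> 'v) set \<Rightarrow> ('v \<Rightarrow> 'v) list \<Rightarrow> ('v \<Rightarrow> 'v) \<Rightarrow> (nat set \<times> nat set) set" where
  "increasing_flip_graph S Q \<rho> =
     {(I, J). I \<in> facets S Q \<rho> \<and> J \<in> facets S Q \<rho> \<and> (\<exists>i\<in>I. \<exists>j\<in>J. I - {i} = J - {j} \<and> i < j)}"

definition p_label :: "nat set \<Rightarrow> nat set \<Rightarrow> nat" where
  "p_label I J = (THE i. i \<in> I \<and> (\<exists>j\<in>J. I - {i} = J - {j} \<and> i < j))"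

definition positive_greedy_facet ::
  "('v \<Rightarrow> 'v) set \<Rightarrow> ('v \<Rightarrow> 'v) list \<Rightarrow> ('v \<Rightarrow> 'v) \<Rightarrow> nat set" where
  "positive_greedy_facet S Q \<rho> =
     (THE I. I \<in> facets S Q \<rho> \<and> (\<forall>J. (J, I) \<notin> increasing_flip_graph S Q \<rho>))"

(* A path is the list of its successive vertices; one-vertex paths are allowed. *)
definition p_rising_path ::
  "('v \<Rightarrow> 'v) set \<Rightarrow> ('v \<Rightarrow> 'v) list \<Rightarrow> ('v \<Rightarrow> 'v) \<Rightarrow> nat set list \<Rightarrow> bool" where
  "p_rising_path S Q \<rho> Is \<longleftrightarrow>
     Is \<noteq> [] \<and> set Is \<subseteq> facets S Q \<rho> \<and>
     successively (\<lambda>I J. (I, J) \<in> increasing_flip_graph S Q \<rho>) Is \<and>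
     sorted_wrt (<) (map2 p_label Is (tl Is))"

(* The positive source tree is the union of these paths. *)
definition positive_source_paths ::
  "('v \<Rightarrow> 'v) set \<Rightarrow> ('v \<Rightarrow> 'v) list \<Rightarrow> ('v \<Rightarrow> 'v) \<Rightarrow> nat set list set" where
  "positive_source_paths S Q \<rho> =
     {Is. p_rising_path S Q \<rho> Is \<and> hd Is = positive_greedy_facet S Q \<rho>}"

definition positive_source_tree ::
  "('v \<Rightarrow> 'v) set \<Rightarrow> ('v \<Rightarrow> 'v) list \<Rightarrow> ('v \<Rightarrow> 'v) \<Rightarrow> (nat set \<times> nat set) set" where
  "positive_source_tree S Q \<rho> =
     (\<Union>Is \<in> positive_source_paths S Q \<rho>. set (zip Is (tl Is)))"

definition father ::
  "('v \<Rightarrow> 'v) set \<Rightarrow> ('v \<Rightarrow> 'v) list \<Rightarrow> ('v \<Rightarrow> 'v) \<Rightarrow> nat set \<Rightarrow> nat set" where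
  "father S Q \<rho> I = (THE J. \<exists>Is. Is @ [J, I] \<in> positive_source_paths S Q \<rho>)"

end

(* Let X be the complement of a facet I. If the root function of I is negative at k, it is the
   negative of the root at some earlier position j of X, and flipping k to j is a decreasing flip;
   hence I is positive greedy iff all its roots are positive. An increasing flip with label i
   from a facet that is greedy on the suffix starting at i yields a facet that is greedy on the
   suffix starting at i + 1 but not on the one starting at i. So y is the label of the last edge of every p-rising path from the
   greedy facet to I. If that edge flipped to a position of I before x, the root at x would
   already be negative in the preceding facet, whose suffix from y is greedy; hence it flips to x.
   Conversely, the facet obtained by flipping x to y is greedy from y on, and induction on the
   sum of the elements of the facet gives a rising path to it with labels smaller than y. *)
theory Submission
  imports Defs
begin

declare One_nat_def [simp del]

section \<open>Reflections and words\<close>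

lemma reflection_self: "reflection v v = - v"
  by (cases "v = 0") (simp_all add: reflection_def scaleR_2)

lemma reflection_uminus: "reflection (- v) = reflection v"
  by (simp add: reflection_def fun_eq_iff)

lemma orthogonal_reflection: "orthogonal_transformation (reflection v)"
\<comment> \<open>For \<open>v = 0\<close> the subtracted multiple of \<open>v\<close> vanishes, so
  \<open>reflection v\<close> is then the identity.\<close>
proof (cases "v = 0")
  case True
  then have "reflection v = id"
    by (simp add: reflection_def fun_eq_iff)
  then show ?thesis
    by (simp add: orthogonal_transformation_id id_def)
next
  case False
  have "linear (reflection v)"
    by (rule linearI)
       (simp_all add: reflection_def inner_add_left algebra_simps add_divide_distrib)
  moreover have "reflection v x \<bullet> reflection v y = x \<bullet> y" for x y
    using False
    by (simp add: reflection_def inner_diff_left inner_diff_right inner_commute field_simps)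
  ultimately show ?thesis
    by (simp add: orthogonal_transformation_def)
qed

lemma reflection_reflection: "reflection v (reflection v x) = x"
proof (cases "v = 0")
  case False
  then have "reflection v x \<bullet> v = - (x \<bullet> v)"
    by (simp add: reflection_def inner_diff_left)
  then show ?thesis
    unfolding reflection_def[of v "reflection v x"] by (simp add: reflection_def)
qed (simp add: reflection_def)

text \<open>An orthogonal map preserves the inner products in the coefficient of \<open>v\<close>,
  so conjugating by \<open>g\<close> turns the reflection in \<open>v\<close> into the one in
  \<open>g v\<close>.\<close>

lemma reflection_conjugate:
  assumes "orthogonal_transformation g"
  shows "g (reflection v x) = reflection (g v) (g x)"
  using assms by (simp add: reflection_def orthogonal_transformation_def linear_diff linear_scale)

text \<open>Evaluate both reflections at \<open>u\<close>: one negates \<open>u\<close>, the other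
  shifts it by a multiple of \<open>v\<close>, so twice \<open>u\<close> is such a multiple.\<close>

lemma reflection_eq_imp_span:
  assumes "reflection u = reflection v"
  shows "u \<in> span {v}"
proof -
  have "- u = u - (2 * (u \<bullet> v) / (v \<bullet> v)) *\<^sub>R v"
    using reflection_self[of u] assms by (simp add: reflection_def)
  then have "2 *\<^sub>R u = (2 * (u \<bullet> v) / (v \<bullet> v)) *\<^sub>R v"
    by (simp add: scaleR_2 algebra_simps)
  then have "(1 / 2) *\<^sub>R 2 *\<^sub>R u = (1 / 2) *\<^sub>R (2 * (u \<bullet> v) / (v \<bullet> v)) *\<^sub>R v"
    by simp
  then have "u = ((u \<bullet> v) / (v \<bullet> v)) *\<^sub>R v"
    by simp
  then show ?thesis
    by (metis span_base span_scale singletonI)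
qed

section \<open>Products of words, and of subwords given by positions\<close>

lemma word_prod_append: "word_prod (xs @ ys) = word_prod xs \<circ> word_prod ys"
  by (induction xs) (simp_all add: word_prod_def o_assoc)

lemma word_prod_Nil [simp]: "word_prod [] = id"
  by (simp add: word_prod_def)

lemma word_prod_singleton [simp]: "word_prod [s] = s"
  by (simp add: word_prod_def)

text \<open>Trades list indices from 0 for positions from 1, so that cutting a set of positions
  becomes splitting a filtered interval.\<close>

lemma subword_conv_filter:
  "subword Q X = map (letter Q) (filter (\<lambda>k. k \<in> X) [1..<Suc (length Q)])"
proof (induction Q rule: rev_induct)
  case (snoc q Q)
  have "map (letter (Q @ [q])) (filter (\<lambda>k. k \<in> X) [1..<Suc (length Q)])
      = map (letter Q) (filter (\<lambda>k. k \<in> X) [1..<Suc (length Q)])"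
    by (rule map_cong) (auto simp: letter_def nth_append)
  then show ?case
    using snoc by (simp add: subword_def nths_append letter_def)
qed (simp add: subword_def)

lemma filter_sorted_split:
  fixes xs :: "'a::linorder list"
  assumes "sorted xs"
  shows "filter (\<lambda>x. x \<in> X) xs
    = filter (\<lambda>x. x \<in> X \<inter> {..<k}) xs @ filter (\<lambda>x. x \<in> X \<inter> {k..}) xs"
  using assms
proof (induction xs)
  case (Cons x xs)
  show ?case
  proof (cases "x < k")
    case False
    then have "filter (\<lambda>x. x \<in> X \<inter> {..<k}) (x # xs) = []"
      using Cons.prems by (auto simp: filter_empty_conv)
    moreover have "filter (\<lambda>x. x \<in> X) (x # xs) = filter (\<lambda>x. x \<in> X \<inter> {k..}) (x # xs)"
      using False Cons.prems by (intro filter_cong) auto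
    ultimately show ?thesis by simp
  qed (use Cons in auto)
qed simp

lemma subword_split: "subword Q X = subword Q (X \<inter> {..<k}) @ subword Q (X \<inter> {k..})"
  unfolding subword_conv_filter
  by (subst filter_sorted_split[where k = k]) (simp_all del: upt_Suc)

lemma subword_prod_split:
  "subword_prod Q X = subword_prod Q (X \<inter> {..<k}) \<circ> subword_prod Q (X \<inter> {k..})"
  unfolding subword_prod_def by (subst subword_split[where k = k]) (rule word_prod_append)

lemma subword_prod_empty [simp]: "subword_prod Q {} = id"
  by (simp add: subword_prod_def subword_conv_filter)

lemma subword_singleton:
  assumes "k \<in> {1..length Q}"
  shows "subword Q {k} = [letter Q k]"
proof -
  have "[1..<Suc (length Q)] = [1..<k] @ k # [Suc k..<Suc (length Q)]"
    using assms upt_add_eq_append[of 1 k "Suc (length Q) - k"] by (simp add: upt_conv_Cons)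
  moreover have "filter (\<lambda>i. i \<in> {k}) [1..<k] = []" "filter (\<lambda>i. i \<in> {k}) [Suc k..<Suc (length Q)] = []"
    by (auto simp: filter_empty_conv)
  ultimately show ?thesis
    unfolding subword_conv_filter by simp
qed

lemma subword_prod_from:
  assumes "k \<in> {1..length Q}"
  shows "subword_prod Q (X \<inter> {k..})
    = (if k \<in> X then letter Q k else id) \<circ> subword_prod Q (X \<inter> {Suc k..})"
proof -
  have *: "X \<inter> {k..} \<inter> {..<Suc k} = (if k \<in> X then {k} else {})"
    "X \<inter> {k..} \<inter> {Suc k..} = X \<inter> {Suc k..}"
    by (auto simp: less_Suc_eq)
  have "subword_prod Q {k} = letter Q k"
    using subword_singleton[OF assms] by (simp add: subword_prod_def)
  then show ?thesis
    by (subst subword_prod_split[where k = "Suc k"]) (simp add: *)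
qed

lemma length_subword:
  assumes "X \<subseteq> {1..length Q}"
  shows "length (subword Q X) = card X"
proof -
  have "set (filter (\<lambda>k. k \<in> X) [1..<Suc (length Q)]) = X"
    using assms by auto
  then show ?thesis
    unfolding subword_conv_filter
    by (metis distinct_card distinct_filter distinct_upt length_map)
qed

lemma subword_drop:
  assumes "X \<subseteq> {n<..}"
  shows "subword (drop n Q) ({k. n + k \<in> X}) = subword Q X"
proof -
  \<comment> \<open>Index \<open>k\<close> carries position \<open>Suc k\<close>. The positions in
    \<open>X\<close> exceed \<open>n\<close>, so their indices are at least \<open>n\<close> and
    survive \<open>drop n\<close>.\<close>
  have "(+) n ` {k. Suc k \<in> {k. n + k \<in> X}} = {k. Suc k \<in> X}"
  proof safe
    fix k assume "Suc k \<in> X"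
    moreover from this have "n \<le> k"
      using assms by auto
    ultimately show "k \<in> (+) n ` {k. Suc k \<in> {k. n + k \<in> X}}"
      by (intro image_eqI[of _ _ "k - n"]) auto
  qed simp
  then show ?thesis
    by (simp add: subword_def nths_drop)
qed

section \<open>Positive roots\<close>

context finite_coxeter_system
begin

abbreviation pos_roots :: "'v set" where
  "pos_roots \<equiv> positive_roots S \<Phi> \<alpha>"

lemma inj_on_simple: "inj_on \<alpha> S"
  by (metis inj_onI simple_reflection)

lemma finite_S: "finite S"
  using simple_independent inj_on_simple independent_imp_finite finite_image_iff by blast

lemma simple_coefficients_zero:
  assumes "(\<Sum>s\<in>S. c s *\<^sub>R \<alpha> s) = 0" "s \<in> S"
  shows "c s = 0"
proof -
  \<comment> \<open>Independence speaks of the set of simple roots, so the coefficients are moved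
    from letters to roots by the inverse of \<open>\<alpha>\<close>.\<close>
  have "(\<Sum>v\<in>\<alpha> ` S. c (the_inv_into S \<alpha> v) *\<^sub>R v) = 0"
    using assms(1) inj_on_simple by (simp add: sum.reindex the_inv_into_f_f)
  then have "c (the_inv_into S \<alpha> (\<alpha> s)) = 0"
    using independentD[OF simple_independent _ subset_refl,
        where u = "\<lambda>v. c (the_inv_into S \<alpha> v)" and v = "\<alpha> s"] finite_S assms(2)
    by simp
  then show ?thesis
    using assms(2) inj_on_simple by (simp add: the_inv_into_f_f)
qed

lemma root_cases:
  assumes "\<beta> \<in> \<Phi>"
  shows "\<beta> \<in> pos_roots \<or> - \<beta> \<in> pos_roots"
  using assms root_decomposition by force

lemma pos_root_is_root: "\<beta> \<in> pos_roots \<Longrightarrow> \<beta> \<in> \<Phi>"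
  by (simp add: positive_roots_def)

text \<open>Adding nonnegative expansions of a root and its negative gives a vanishing combination
  of simple roots; independence makes all coefficients zero, but a root is nonzero.\<close>

lemma pos_root_not_neg:
  assumes "\<beta> \<in> pos_roots"
  shows "- \<beta> \<notin> pos_roots"
proof
  assume "- \<beta> \<in> pos_roots"
  then obtain d where d: "\<forall>s\<in>S. d s \<ge> 0" "- \<beta> = (\<Sum>s\<in>S. d s *\<^sub>R \<alpha> s)"
    by (auto simp: positive_roots_def)
  obtain c where c: "\<forall>s\<in>S. c s \<ge> 0" "\<beta> = (\<Sum>s\<in>S. c s *\<^sub>R \<alpha> s)"
    using assms by (auto simp: positive_roots_def)
  have "(\<Sum>s\<in>S. (c s + d s) *\<^sub>R \<alpha> s) = \<beta> + - \<beta>"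
    unfolding d(2) unfolding c(2) by (simp add: scaleR_add_left sum.distrib)
  then have "c s + d s = 0" if "s \<in> S" for s
    using simple_coefficients_zero[of "\<lambda>s. c s + d s"] that by simp
  then have "c s = 0" if "s \<in> S" for s
    using c(1) d(1) that by (smt (verit))
  then have "\<beta> = 0"
    using c(2) by simp
  then show False
    using assms root_nonzero pos_root_is_root by blast
qed

lemma simple_root_pos:
  assumes "s \<in> S"
  shows "\<alpha> s \<in> pos_roots"
proof -
  have "\<alpha> s = (\<Sum>t\<in>S. (if t = s then 1 else 0) *\<^sub>R \<alpha> t)"
    using assms finite_S by (simp add: if_distrib[of "\<lambda>c. c *\<^sub>R _"] sum.delta cong: if_cong)
  then show ?thesis
    using simple_root[OF assms] unfolding positive_roots_def
    by (intro CollectI conjI exI[of _ "\<lambda>t. if t = s then 1 else 0"]) auto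
qed

text \<open>A simple reflection changes only the coefficient of its own simple root. If the sign of
  \<beta> flips, all other coefficients must be zero, so \<beta> lies on the line of
  \<open>\<alpha> s\<close>.\<close>

lemma pos_root_made_negative:
  assumes "\<beta> \<in> pos_roots" "s \<in> S" "- s \<beta> \<in> pos_roots"
  shows "\<beta> = \<alpha> s"
proof -
  obtain c where c: "\<forall>t\<in>S. c t \<ge> 0" "\<beta> = (\<Sum>t\<in>S. c t *\<^sub>R \<alpha> t)"
    using assms(1) by (auto simp: positive_roots_def)
  obtain d where d: "\<forall>t\<in>S. d t \<ge> 0" "- s \<beta> = (\<Sum>t\<in>S. d t *\<^sub>R \<alpha> t)"
    using assms(3) by (auto simp: positive_roots_def)
  obtain k where k: "s \<beta> = \<beta> - k *\<^sub>R \<alpha> s"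
    using simple_reflection[OF assms(2)] by (metis reflection_def)
  have "(\<Sum>t\<in>S. (if t = s then k else 0) *\<^sub>R \<alpha> t) = k *\<^sub>R \<alpha> s"
    using assms(2) finite_S by (simp add: if_distrib[of "\<lambda>c. c *\<^sub>R _"] sum.delta cong: if_cong)
  then have "(\<Sum>t\<in>S. (c t + d t - (if t = s then k else 0)) *\<^sub>R \<alpha> t) = \<beta> + - s \<beta> - k *\<^sub>R \<alpha> s"
    unfolding d(2) unfolding c(2) 
    by (simp add: scaleR_add_left scaleR_diff_left sum.distrib sum_subtractf)
  also have "\<dots> = 0"
    using k by simp
  finally have "c t + d t - (if t = s then k else 0) = 0" if "t \<in> S" for t
    using simple_coefficients_zero[of "\<lambda>t. c t + d t - (if t = s then k else 0)"] that by simp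
  then have "c t = 0" if "t \<in> S" "t \<noteq> s" for t
    using c(1) d(1) that by (smt (verit))
  then have "\<beta> = (\<Sum>t\<in>S. if t = s then c s *\<^sub>R \<alpha> s else 0)"
    unfolding c(2) by (intro sum.cong) auto
  then have "\<beta> \<in> span {\<alpha> s}"
    using assms(2) finite_S by (simp add: span_base span_scale)
  then have "\<beta> = \<alpha> s \<or> \<beta> = - \<alpha> s"
    using root_line[OF simple_root[OF assms(2)]] pos_root_is_root[OF assms(1)] by blast
  then show ?thesis
    using assms(1) simple_root_pos[OF assms(2)] pos_root_not_neg by fastforce
qed

lemma simple_apply_root:
  "s \<in> S \<Longrightarrow> s (\<alpha> s) = - \<alpha> s"
  using simple_reflection reflection_self by metis

section \<open>Action of words on roots, and word length\<close>

lemma orthogonal_word_prod: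
  "ss \<in> lists S \<Longrightarrow> orthogonal_transformation (word_prod ss)"
proof (induction ss)
  case (Cons s ss)
  then have "orthogonal_transformation s"
    by (metis orthogonal_reflection simple_reflection Cons_in_lists_iff)
  moreover have "word_prod (s # ss) = s \<circ> word_prod ss"
    by (simp add: word_prod_def)
  ultimately show ?case
    using Cons orthogonal_transformation_compose[of s "word_prod ss"]
    by (simp del: o_apply add: comp_def)
qed (simp add: orthogonal_transformation_id id_def)

lemma word_prod_root:
  assumes "ss \<in> lists S" "\<beta> \<in> \<Phi>"
  shows "word_prod ss \<beta> \<in> \<Phi>"
  using roots_stable[of "word_prod ss"] generated assms by blast

lemma reflection_eq_iff:
  assumes "\<beta> \<in> \<Phi>" "\<gamma> \<in> \<Phi>"
  shows "reflection \<beta> = reflection \<gamma> \<longleftrightarrow> \<beta> = \<gamma> \<or> \<beta> = - \<gamma>"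
  using reflection_eq_imp_span[of \<beta> \<gamma>] root_line[OF assms(2)] assms(1)
  by (auto simp: reflection_uminus)

lemma coxeter_length_le: "ss \<in> lists S \<Longrightarrow> coxeter_length S (word_prod ss) \<le> length ss"
  unfolding coxeter_length_def by (rule Least_le) auto

lemma coxeter_length_attained:
  assumes "ss \<in> lists S"
  obtains ts where "ts \<in> lists S" "word_prod ts = word_prod ss"
    "length ts = coxeter_length S (word_prod ss)"
proof -
  have "\<exists>ts\<in>lists S. length ts = coxeter_length S (word_prod ss) \<and> word_prod ts = word_prod ss"
    unfolding coxeter_length_def by (rule LeastI_ex) (use assms in blast)
  then show ?thesis
    using that by blast
qed

end

section \<open>Roots of a subword\<close>

locale coxeter_word = finite_coxeter_system W S \<Phi> \<alpha>
  for W S :: "('v::euclidean_space \<Rightarrow> 'v) set" and \<Phi> :: "'v set" and \<alpha> :: "('v \<Rightarrow> 'v) \<Rightarrow> 'v" +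
  fixes Q :: "('v \<Rightarrow> 'v) list"
  assumes Q_letters: "Q \<in> lists S"
begin

(* Here X is the set of positions used by the subword, i.e. the complement of a facet. *)
definition rt :: "nat set \<Rightarrow> nat \<Rightarrow> 'v" where
  "rt X k = subword_prod Q (X \<inter> {..<k}) (\<alpha> (letter Q k))"

text \<open>The subword at \<open>X\<close> is a reduced expression of its own product. The bound on
  \<open>X\<close> makes \<open>card X\<close> the length of that subword.\<close>

definition red :: "nat set \<Rightarrow> bool" where
  "red X \<longleftrightarrow> X \<subseteq> {1..length Q} \<and> coxeter_length S (subword_prod Q X) = card X"

lemma letter_in: "k \<in> {1..length Q} \<Longrightarrow> letter Q k \<in> S"
  using Q_letters by (auto simp: letter_def in_lists_conv_set)

lemma subword_in: "subword Q X \<in> lists S"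
  using Q_letters by (auto simp: subword_def in_lists_conv_set dest: in_set_nthsD)

lemma orthogonal_subword_prod: "orthogonal_transformation (subword_prod Q X)"
  unfolding subword_prod_def by (rule orthogonal_word_prod) (rule subword_in)

lemma subword_prod_inj: "subword_prod Q X u = subword_prod Q X v \<longleftrightarrow> u = v"
  using orthogonal_transformation_inj[OF orthogonal_subword_prod] by (auto dest: injD)

lemma subword_prod_uminus: "subword_prod Q X (- u) = - subword_prod Q X u"
  using orthogonal_subword_prod by (simp add: orthogonal_transformation_def linear_neg)

lemma rt_root: "k \<in> {1..length Q} \<Longrightarrow> rt X k \<in> \<Phi>"
  by (simp add: rt_def subword_prod_def word_prod_root subword_in simple_root letter_in)

lemma rt_from:
  assumes "a \<le> k"
  shows "rt X k = subword_prod Q (X \<inter> {..<a}) (rt (X \<inter> {a..}) k)"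
proof -
  have "X \<inter> {..<k} \<inter> {..<a} = X \<inter> {..<a}" "X \<inter> {..<k} \<inter> {a..} = X \<inter> {a..} \<inter> {..<k}"
    using assms by auto
  then show ?thesis
    using subword_prod_split[of Q "X \<inter> {..<k}" a] by (simp add: rt_def)
qed

lemma rt_start: "rt (X \<inter> {k..}) k = \<alpha> (letter Q k)"
proof -
  have "X \<inter> {k..} \<inter> {..<k} = {}" by auto
  then show ?thesis by (simp add: rt_def)
qed

text \<open>The letter at \<open>k\<close> moves left past the prefix before it by conjugation,
  which turns its simple root into \<open>rt X k\<close>.\<close>

lemma subword_prod_insert:
  assumes "k \<in> {1..length Q}" "k \<notin> X"
  shows "subword_prod Q (insert k X) = reflection (rt X k) \<circ> subword_prod Q X"
proof -
  have *: "insert k X \<inter> {..<k} = X \<inter> {..<k}" "insert k X \<inter> {Suc k..} = X \<inter> {Suc k..}"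
    by auto
  have "subword_prod Q (insert k X)
      = subword_prod Q (X \<inter> {..<k}) \<circ> (letter Q k \<circ> subword_prod Q (X \<inter> {Suc k..}))"
    using subword_prod_split[of Q "insert k X" k] subword_prod_from[OF assms(1), of "insert k X"]
    by (simp add: *)
  also have "\<dots> = reflection (rt X k) \<circ> (subword_prod Q (X \<inter> {..<k}) \<circ> subword_prod Q (X \<inter> {Suc k..}))"
    using reflection_conjugate[OF orthogonal_subword_prod] simple_reflection[OF letter_in[OF assms(1)]]
    by (auto simp: fun_eq_iff rt_def)
  also have "subword_prod Q (X \<inter> {..<k}) \<circ> subword_prod Q (X \<inter> {Suc k..}) = subword_prod Q X"
    using subword_prod_split[of Q X k] subword_prod_from[OF assms(1), of X] assms(2) by simp
  finally show ?thesis .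
qed

lemma rt_insert_le:
  assumes "k \<le> j"
  shows "rt (insert j X) k = rt X k"
proof -
  have "insert j X \<inter> {..<k} = X \<inter> {..<k}" using assms by auto
  then show ?thesis by (simp add: rt_def)
qed

text \<open>This is \<open>subword_prod_insert\<close> for the prefix before \<open>k\<close>, in
  which \<open>j\<close> has the same root as in \<open>X\<close>.\<close>

lemma rt_insert_gt:
  assumes "j \<in> {1..length Q}" "j \<notin> X" "j < k"
  shows "rt (insert j X) k = reflection (rt X j) (rt X k)"
proof -
  have "insert j X \<inter> {..<k} = insert j (X \<inter> {..<k})" "X \<inter> {..<k} \<inter> {..<j} = X \<inter> {..<j}"
    using assms(3) by auto
  then show ?thesis
    using subword_prod_insert[of j "X \<inter> {..<k}"] assms by (simp add: rt_def)
qed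

lemma rt_cases:
  assumes "k \<in> {1..length Q}"
  shows "rt X k \<in> pos_roots \<or> - rt X k \<in> pos_roots"
  by (rule root_cases) (rule rt_root[OF assms])

lemma rt_step:
  assumes "a \<in> {1..length Q}" "a < k"
  shows "rt (X \<inter> {a..}) k
    = (if a \<in> X then letter Q a (rt (X \<inter> {Suc a..}) k) else rt (X \<inter> {Suc a..}) k)"
proof (cases "a \<in> X")
  case True
  have "X \<inter> {a..} = insert a (X \<inter> {Suc a..})" "rt (X \<inter> {Suc a..}) a = \<alpha> (letter Q a)"
  proof -
    show "X \<inter> {a..} = insert a (X \<inter> {Suc a..})" using True by auto
    have "X \<inter> {Suc a..} \<inter> {..<a} = {}" by auto
    then show "rt (X \<inter> {Suc a..}) a = \<alpha> (letter Q a)" by (simp add: rt_def)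
  qed
  then show ?thesis
    using rt_insert_gt[of a "X \<inter> {Suc a..}" k] assms True simple_reflection[OF letter_in]
    by simp
next
  case False
  then have "X \<inter> {a..} = X \<inter> {Suc a..}"
    by (auto simp: Suc_le_eq order.strict_iff_order)
  then show ?thesis using False by simp
qed

(* Reading the subword from right to left, a negative root must change sign at some letter. *)
lemma negative_rt_matched:
  assumes "k \<in> {1..length Q}" "- rt X k \<in> pos_roots"
  obtains j where "j \<in> X" "1 \<le> j" "j < k" "rt X k = - rt X j"
proof -
  let ?P = "\<lambda>a. a \<ge> 1 \<and> rt (X \<inter> {a..}) k \<in> pos_roots"
  \<comment> \<open>At start \<open>k\<close> the root is simple, hence positive; at start 1 it is
    the negative \<open>rt X k\<close>. So the least start with a positive root is some
    \<open>Suc j\<close> with \<open>j\<close> a position, and the sign changes at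
    \<open>j\<close>.\<close>
  define a where "a = (LEAST a. ?P a)"
  have k: "?P k"
    using assms(1) by (simp add: rt_start simple_root_pos letter_in)
  then have a: "?P a" "a \<le> k"
    unfolding a_def by (rule LeastI, rule Least_le)
  \<comment> \<open>\<open>X\<close> may contain 0, which names no letter, so cutting at 1 leaves
    every subword unchanged.\<close>
  have one: "rt (X \<inter> {1..}) k = rt X k"
  proof -
    have "subword Q (X \<inter> {1..} \<inter> {..<k}) = subword Q (X \<inter> {..<k})"
      unfolding subword_conv_filter by (intro arg_cong[where f = "map _"] filter_cong) auto
    then show ?thesis by (simp add: rt_def subword_prod_def)
  qed
  have "a \<noteq> 1"
    using a(1) one assms(2) pos_root_not_neg by metis
  then obtain j where j: "a = Suc j" "1 \<le> j"
    using a(1) by (cases a) auto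
  have jQ: "j \<in> {1..length Q}" "j < k"
    using j a(2) assms(1) by auto
  have "\<not> ?P j"
    using j(1) not_less_Least[of j ?P] unfolding a_def by linarith
  then have neg: "- rt (X \<inter> {j..}) k \<in> pos_roots"
    using j(2) rt_cases[OF assms(1), of "X \<inter> {j..}"] by blast
  have "j \<in> X"
  proof (rule ccontr)
    assume "j \<notin> X"
    then show False
      using rt_step[OF jQ, of X] neg a(1) j(1) pos_root_not_neg by auto
  qed
  then have st: "rt (X \<inter> {j..}) k = letter Q j (rt (X \<inter> {Suc j..}) k)"
    using rt_step[OF jQ, of X] by simp
  \<comment> \<open>The letter at \<open>j\<close> makes a positive root negative, and the only such
    root is its own simple root.\<close>
  then have "rt (X \<inter> {Suc j..}) k = \<alpha> (letter Q j)"
    using neg a(1) j(1) jQ(1) letter_in by (intro pos_root_made_negative) auto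
  then have "rt (X \<inter> {j..}) k = - rt (X \<inter> {j..}) j"
    using st jQ(1) letter_in by (simp add: simple_apply_root rt_start)
  then have "rt X k = - rt X j"
    using rt_from[of j k X] rt_from[of j j X] jQ(2) by (simp add: subword_prod_uminus)
  then show ?thesis
    using that \<open>j \<in> X\<close> jQ by auto
qed

text \<open>Were the roots equal up to sign, inserting both positions would multiply by the same
  reflection twice. The letters at \<open>Y\<close> would then express a product whose length is
  \<open>card Y + 2\<close>.\<close>

lemma red_distinct_insert:
  assumes "red (insert j (insert k Y))" "j \<notin> Y" "k \<notin> Y" "j \<noteq> k"
  shows "rt Y j \<noteq> rt Y k" "rt Y j \<noteq> - rt Y k"
proof -
  \<comment> \<open>For \<open>j < k\<close> inserting \<open>k\<close> keeps the root at
    \<open>j\<close>; the other order follows by symmetry.\<close>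
  have *: "rt Y j \<noteq> rt Y k \<and> rt Y j \<noteq> - rt Y k"
    if "red (insert j (insert k Y))" "j \<notin> Y" "k \<notin> Y" "j < k" for j k
  proof (rule ccontr)
    assume "\<not> ?thesis"
    then have refl: "reflection (rt Y j) = reflection (rt Y k)"
      using reflection_uminus by metis
    have Q: "j \<in> {1..length Q}" "k \<in> {1..length Q}" "Y \<subseteq> {1..length Q}"
      using that(1) by (auto simp: red_def)
    have "finite Y"
      using Q(3) by (rule finite_subset) simp
    have "subword_prod Q (insert j (insert k Y)) = subword_prod Q Y"
      using subword_prod_insert[of j "insert k Y"] subword_prod_insert[of k Y] Q that
        rt_insert_le[of j k Y] refl
      by (auto simp: fun_eq_iff reflection_reflection)
    then have "card (insert j (insert k Y)) = coxeter_length S (subword_prod Q Y)"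
      using that(1) by (simp add: red_def)
    also have "\<dots> \<le> card Y"
      using coxeter_length_le[OF subword_in] length_subword[OF Q(3)]
      by (metis subword_prod_def)
    finally show False
      using that \<open>finite Y\<close> by simp
  qed
  have "rt Y j \<noteq> rt Y k \<and> rt Y j \<noteq> - rt Y k"
  proof (cases "j < k")
    case False
    then have "rt Y k \<noteq> rt Y j \<and> rt Y k \<noteq> - rt Y j"
      using *[of k j] assms by (simp add: insert_commute)
    then show ?thesis
      by (metis minus_minus)
  qed (use * assms in blast)
  then show "rt Y j \<noteq> rt Y k" "rt Y j \<noteq> - rt Y k"
    by simp_all
qed

text \<open>Passing from \<open>Y\<close> to \<open>X\<close> keeps the root at \<open>j\<close> and
  reflects the root at \<open>k\<close> in it. Roots that agree up to sign in \<open>X\<close> would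
  therefore agree up to sign in \<open>Y\<close>.\<close>

lemma red_distinct:
  assumes "red X" "j \<in> X" "k \<in> X" "j < k"
  shows "rt X j \<noteq> rt X k" "rt X j \<noteq> - rt X k"
proof -
  define Y where "Y = X - {j, k}"
  have X: "X = insert j (insert k Y)" and n: "j \<notin> Y" "k \<notin> Y"
    using assms by (auto simp: Y_def)
  have jQ: "j \<in> {1..length Q}"
    using assms by (auto simp: red_def)
  have j: "rt X j = rt Y j"
    unfolding X using assms(4) by (simp add: rt_insert_le)
  have "rt X k = reflection (rt Y j) (rt Y k)"
    unfolding X using rt_insert_gt[of j "insert k Y" k] n jQ assms(4)
    by (simp add: rt_insert_le)
  then have k: "reflection (rt Y j) (rt X k) = rt Y k"
    by (simp add: reflection_reflection)
  have "rt Y j \<noteq> rt Y k" "rt Y j \<noteq> - rt Y k"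
    using red_distinct_insert[of j k Y] assms n unfolding X by auto
  then show "rt X j \<noteq> rt X k" "rt X j \<noteq> - rt X k"
    using k reflection_self[of "rt Y j"] reflection_self[of "- rt Y j"]
    unfolding j reflection_uminus by fastforce+
qed

text \<open>A negative root would be the opposite of the root at an earlier used position, which
  \<open>red_distinct\<close> excludes.\<close>

lemma red_rt_pos:
  assumes "red X" "k \<in> X"
  shows "rt X k \<in> pos_roots"
proof (rule ccontr)
  assume "rt X k \<notin> pos_roots"
  moreover have k: "k \<in> {1..length Q}"
    using assms by (auto simp: red_def)
  ultimately obtain j where "j \<in> X" "j < k" "rt X k = - rt X j"
    using rt_cases negative_rt_matched by metis
  then show False
    using red_distinct(2)[OF assms(1), of j k] assms(2) by simp
qed

text \<open>A shorter word \<open>ts\<close> for the product of the suffix, put after the prefix,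
  would shorten a reduced word.\<close>

lemma red_from:
  assumes "red X"
  shows "red (X \<inter> {a..})"
proof -
  have XQ: "X \<subseteq> {1..length Q}"
    using assms by (simp add: red_def)
  then have fin: "finite X"
    by (rule finite_subset) simp
  obtain ts where ts: "ts \<in> lists S" "word_prod ts = subword_prod Q (X \<inter> {a..})"
    "length ts = coxeter_length S (subword_prod Q (X \<inter> {a..}))"
    using coxeter_length_attained[OF subword_in] by (metis subword_prod_def)
  have "subword_prod Q X = word_prod (subword Q (X \<inter> {..<a}) @ ts)"
    using subword_prod_split[of Q X a] ts(2) by (simp add: word_prod_append subword_prod_def)
  then have "coxeter_length S (subword_prod Q X) \<le> length (subword Q (X \<inter> {..<a}) @ ts)"
    using coxeter_length_le[of "subword Q (X \<inter> {..<a}) @ ts"] ts(1) subword_in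
    by (simp add: append_in_lists_conv)
  moreover have "length (subword Q (X \<inter> {..<a})) = card (X \<inter> {..<a})"
    using XQ by (intro length_subword) auto
  moreover have "card X = card (X \<inter> {..<a}) + card (X \<inter> {a..})"
  proof -
    have "X = (X \<inter> {..<a}) \<union> (X \<inter> {a..})" by auto
    then show ?thesis
      using card_Un_disjoint[of "X \<inter> {..<a}" "X \<inter> {a..}"] fin
      by (metis Int_assoc Int_left_commute disjoint_iff finite_Int Int_iff lessThan_iff atLeast_iff leD)
  qed
  ultimately have "card (X \<inter> {a..}) \<le> coxeter_length S (subword_prod Q (X \<inter> {a..}))"
    using assms ts(3) by (simp add: red_def)
  moreover have "coxeter_length S (subword_prod Q (X \<inter> {a..})) \<le> card (X \<inter> {a..})"
    using coxeter_length_le[OF subword_in, of "X \<inter> {a..}"]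
      length_subword[OF subset_trans[OF Int_lower1 XQ], of "{a..}"]
    by (simp add: subword_prod_def)
  ultimately show ?thesis
    using XQ by (auto simp: red_def)
qed

text \<open>Roots equal up to sign have the same reflection, so either position extends
  \<open>Y\<close> to the same product with the same number of letters.\<close>

lemma red_exchange:
  assumes "red (insert i Y)" "i \<notin> Y" "j \<notin> Y" "j \<in> {1..length Q}"
    and "rt Y i = rt Y j \<or> rt Y i = - rt Y j"
  shows "red (insert j Y)" "subword_prod Q (insert j Y) = subword_prod Q (insert i Y)"
proof -
  have i: "i \<in> {1..length Q}" and Y: "Y \<subseteq> {1..length Q}"
    using assms(1) by (auto simp: red_def)
  have "finite Y"
    using Y by (rule finite_subset) simp
  show *: "subword_prod Q (insert j Y) = subword_prod Q (insert i Y)"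
    using subword_prod_insert[OF i assms(2)] subword_prod_insert[OF assms(4,3)] assms(5)
    by (auto simp: reflection_uminus)
  show "red (insert j Y)"
    using assms(1-4) Y \<open>finite Y\<close> by (simp add: red_def *)
qed

text \<open>Converse of the exchange: cancelling the product of \<open>Y\<close> leaves equal
  reflections, hence roots equal up to sign.\<close>

lemma exchange_rt:
  assumes "i \<in> {1..length Q}" "j \<in> {1..length Q}" "i \<notin> Y" "j \<notin> Y"
    and "subword_prod Q (insert j Y) = subword_prod Q (insert i Y)"
  shows "rt Y i = rt Y j \<or> rt Y i = - rt Y j"
proof -
  have "reflection (rt Y i) (subword_prod Q Y v) = reflection (rt Y j) (subword_prod Q Y v)" for v
    using subword_prod_insert[of i Y] subword_prod_insert[of j Y] assms by (auto simp: fun_eq_iff)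
  moreover have "surj (subword_prod Q Y)"
    using orthogonal_transformation_surj orthogonal_subword_prod by blast
  ultimately have "reflection (rt Y i) = reflection (rt Y j)"
    by (metis ext surjD)
  then show ?thesis
    using reflection_eq_iff rt_root assms(1,2) by metis
qed

text \<open>Both roots come from their suffix counterparts by one linear bijection, the product of
  the prefix before \<open>a\<close>. Relations between two roots can thus be tested in any suffix
  containing both positions.\<close>

lemma rt_from_eq:
  assumes "a \<le> j" "a \<le> k"
  shows "rt X j = rt X k \<longleftrightarrow> rt (X \<inter> {a..}) j = rt (X \<inter> {a..}) k"
  using rt_from[OF assms(1), of X] rt_from[OF assms(2), of X] subword_prod_inj by simp

lemma rt_from_eq_minus:
  assumes "a \<le> j" "a \<le> k"
  shows "rt X j = - rt X k \<longleftrightarrow> rt (X \<inter> {a..}) j = - rt (X \<inter> {a..}) k"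
  using rt_from[OF assms(1), of X] rt_from[OF assms(2), of X] subword_prod_inj
  by (metis subword_prod_uminus)

text \<open>Take the largest position \<open>k\<close> where the sets differ, say in
  \<open>Y\<close> only, and pull its simple root back through the common tail to \<open>u\<close>.
  The product of \<open>X\<close> sends \<open>u\<close> to \<open>rt X k\<close>, that of
  \<open>Y\<close> sends it to \<open>- rt Y k\<close>; as the products agree, these roots cannot
  both be positive.\<close>

lemma all_pos_unique:
  assumes "X \<subseteq> {1..length Q}" "Y \<subseteq> {1..length Q}"
    and "\<forall>k\<in>{1..length Q}. rt X k \<in> pos_roots" "\<forall>k\<in>{1..length Q}. rt Y k \<in> pos_roots"
    and "subword_prod Q X = subword_prod Q Y"
  shows "X = Y"
proof (rule ccontr)
  have *: False
    if "k \<in> {1..length Q}" "k \<in> Y" "k \<notin> X" "X \<inter> {Suc k..} = Y \<inter> {Suc k..}"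
      "rt X k \<in> pos_roots" "rt Y k \<in> pos_roots" "subword_prod Q X = subword_prod Q Y" for X Y k
  proof -
    obtain u where u: "subword_prod Q (Y \<inter> {Suc k..}) u = \<alpha> (letter Q k)"
      using orthogonal_transformation_surj[OF orthogonal_subword_prod] by (metis surjD)
    have "subword_prod Q X u = rt X k"
      using subword_prod_split[of Q X k] subword_prod_from[of k Q X] that(1,3,4) u
      by (simp add: rt_def)
    moreover have "subword_prod Q Y u = - rt Y k"
      using subword_prod_split[of Q Y k] subword_prod_from[of k Q Y] that(1,2) u
      by (simp add: rt_def simple_apply_root letter_in subword_prod_uminus)
    ultimately show False
      using that(5-7) pos_root_not_neg by metis
  qed
  assume "X \<noteq> Y"
  define D where "D = (X - Y) \<union> (Y - X)"
  define k where "k = Max D"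
  have fin: "finite D"
    using assms(1,2) unfolding D_def by (meson finite_Un finite_Diff finite_subset finite_atLeastAtMost)
  moreover have "D \<noteq> {}"
    using \<open>X \<noteq> Y\<close> by (auto simp: D_def)
  ultimately have k: "k \<in> D"
    unfolding k_def by (rule Max_in)
  have "j \<notin> D" if "Suc k \<le> j" for j
    using Max_ge[OF fin, of j] that by (auto simp: k_def)
  then have tail: "X \<inter> {Suc k..} = Y \<inter> {Suc k..}"
    unfolding D_def by blast
  have kQ: "k \<in> {1..length Q}"
    using k assms(1,2) by (auto simp: D_def)
  show False
    using k *[of k Y X] *[of k X Y] tail kQ assms(3-5) unfolding D_def by auto
qed

section \<open>Greedy facets and increasing flips\<close>

(* For the complement X of a facet I, this says that the part of I from position a onwards
   is the positive greedy facet of the corresponding suffix of Q (suffix_greedy_iff). *)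
definition greedy_from :: "nat \<Rightarrow> nat set \<Rightarrow> bool" where
  "greedy_from a X \<longleftrightarrow> (\<forall>k\<in>{a..length Q}. rt (X \<inter> {a..}) k \<in> pos_roots)"

text \<open>A negative root in the shorter suffix is the opposite of an earlier root there. The
  relation persists in the longer suffix, where both roots are positive.\<close>

lemma greedy_from_mono:
  assumes "greedy_from a X" "1 \<le> a" "a \<le> b"
  shows "greedy_from b X"
  unfolding greedy_from_def
proof (rule ballI, rule ccontr)
  fix k assume k: "k \<in> {b..length Q}" "rt (X \<inter> {b..}) k \<notin> pos_roots"
  then have kQ: "k \<in> {1..length Q}"
    using assms by auto
  then obtain j where j: "j \<in> X \<inter> {b..}" "j < k" "rt (X \<inter> {b..}) k = - rt (X \<inter> {b..}) j"
    using k rt_cases[OF kQ, of "X \<inter> {b..}"] negative_rt_matched[OF kQ] by metis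
  have "X \<inter> {a..} \<inter> {b..} = X \<inter> {b..}"
    using assms(3) by auto
  then have "rt (X \<inter> {a..}) k = - rt (X \<inter> {a..}) j"
    using rt_from_eq_minus[of b k j "X \<inter> {a..}"] j k(1) by simp
  moreover have "rt (X \<inter> {a..}) k \<in> pos_roots" "rt (X \<inter> {a..}) j \<in> pos_roots"
    using assms(1,3) k(1) j by (auto simp: greedy_from_def)
  ultimately show False
    using pos_root_not_neg by metis
qed

lemma greedy_from_1:
  assumes "X \<subseteq> {1..length Q}"
  shows "greedy_from 1 X \<longleftrightarrow> (\<forall>k\<in>{1..length Q}. rt X k \<in> pos_roots)"
proof -
  have "X \<inter> {1..} = X" using assms by auto
  then show ?thesis by (simp add: greedy_from_def)
qed

section \<open>Facets and flips in terms of complements and their roots\<close>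

lemma facets_iff:
  "I \<in> facets S Q \<rho> \<longleftrightarrow> I \<subseteq> {1..length Q} \<and> red ({1..length Q} - I)
    \<and> subword_prod Q ({1..length Q} - I) = \<rho>"
  using length_subword[of "{1..length Q} - I" Q] subword_in
  by (auto simp: facets_def reduced_expression_def red_def subword_prod_def)

lemma root_function_eq_rt:
  assumes "k \<in> {1..length Q}"
  shows "root_function \<alpha> Q I k = rt ({1..length Q} - I) k"
proof -
  have "({1..length Q} - I) \<inter> {..<k} = {1..<k} - I"
    using assms by auto
  then show ?thesis by (simp add: root_function_def rt_def)
qed

text \<open>The description in \<open>p_label\<close> is unambiguous: any label lies in
  \<open>J\<close> but not in \<open>I\<close>, and \<open>i\<close> is the only such
  element.\<close>

lemma p_label_eq:
  assumes "J - {i} = I - {j}" "i \<in> J" "j \<in> I" "i < j"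
  shows "p_label J I = i"
  unfolding p_label_def
proof (rule the_equality)
  show "i \<in> J \<and> (\<exists>j\<in>I. J - {i} = I - {j} \<and> i < j)"
    using assms by blast
  fix i' assume "i' \<in> J \<and> (\<exists>j\<in>I. J - {i'} = I - {j} \<and> i' < j)"
  then show "i' = i"
    using assms by (metis Diff_iff insertCI insertE less_irrefl singletonD)
qed

text \<open>\<open>Y\<close> collects the positions used by both facets. Equal products make its
  roots at \<open>i\<close> and \<open>j\<close> agree up to sign; both are positive because each is
  the root at a used position of a reduced subword.\<close>

lemma increasing_flipE:
  assumes "(J, I) \<in> increasing_flip_graph S Q \<rho>"
  obtains i j Y where "J = insert i (I - {j})" "i \<notin> I" "j \<in> I" "i < j"
    "p_label J I = i" "i \<in> {1..length Q}" "j \<in> {1..length Q}" "i \<notin> Y" "j \<notin> Y"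
    "{1..length Q} - J = insert j Y" "{1..length Q} - I = insert i Y"
    "red (insert i Y)" "red (insert j Y)" "rt Y i = rt Y j"
proof -
  obtain i j where fac: "J \<in> facets S Q \<rho>" "I \<in> facets S Q \<rho>"
    and ij: "i \<in> J" "j \<in> I" "J - {i} = I - {j}" "i < j"
    using assms by (auto simp: increasing_flip_graph_def)
  define Y where "Y = {1..length Q} - (I \<union> J)"
  have iI: "i \<notin> I" and jJ: "j \<notin> J"
    using ij by auto
  have J: "J = insert i (I - {j})"
    using ij by auto
  have Q: "i \<in> {1..length Q}" "j \<in> {1..length Q}"
    using fac ij unfolding facets_iff by blast+
  have n: "i \<notin> Y" "j \<notin> Y"
    using ij by (auto simp: Y_def)
  have X: "{1..length Q} - J = insert j Y" "{1..length Q} - I = insert i Y"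
    using Q ij iI jJ J unfolding Y_def by auto
  have red: "red (insert i Y)" "red (insert j Y)"
    "subword_prod Q (insert i Y) = subword_prod Q (insert j Y)"
    using fac by (simp_all add: facets_iff X)
  have "rt Y i = rt Y j \<or> rt Y i = - rt Y j"
    using exchange_rt[of i j Y] Q n red(3) by simp
  moreover have "rt Y i \<in> pos_roots" "rt Y j \<in> pos_roots"
    using red_rt_pos[OF red(1), of i] red_rt_pos[OF red(2), of j] by (simp_all add: rt_insert_le)
  ultimately have "rt Y i = rt Y j"
    using pos_root_not_neg by metis
  then show ?thesis
    using that[OF J iI ij(2,4) p_label_eq[OF ij(3,1,2,4)] Q n X red(1,2)] by blast
qed

text \<open>Provides the measure for finding a source and for the induction that builds rising
  paths.\<close>

lemma increasing_flip_sum_less: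
  assumes "(J, I) \<in> increasing_flip_graph S Q \<rho>"
  shows "\<Sum>J < \<Sum>I"
proof -
  obtain i j where ij: "J = insert i (I - {j})" "i \<notin> I" "j \<in> I" "i < j"
    using assms by (rule increasing_flipE) blast
  have "finite I"
    using assms finite_subset[of I "{1..length Q}"]
    by (auto simp: increasing_flip_graph_def facets_iff)
  then show ?thesis
    using ij by (simp add: sum.remove[of I j])
qed

text \<open>Dropping \<open>i\<close> from the used positions reflects the root at \<open>j\<close>
  in the root at \<open>i\<close>, so the two opposite roots become equal and the positions can be
  exchanged.\<close>

lemma increasing_flipI:
  assumes "I \<in> facets S Q \<rho>" "j \<in> I" "i \<in> {1..length Q} - I" "i < j"
    and "rt ({1..length Q} - I) j = - rt ({1..length Q} - I) i"
  shows "(insert i (I - {j}), I) \<in> increasing_flip_graph S Q \<rho>"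
proof -
  let ?X = "{1..length Q} - I"
  define Y where "Y = ?X - {i}"
  have X: "?X = insert i Y" and n: "i \<notin> Y" "j \<notin> Y"
    using assms(2,3) by (auto simp: Y_def)
  have I: "I \<subseteq> {1..length Q}" and red: "red (insert i Y)" "subword_prod Q (insert i Y) = \<rho>"
    using assms(1) by (simp_all add: facets_iff X)
  have jQ: "j \<in> {1..length Q}" and iQ: "i \<in> {1..length Q}"
    using assms(2,3) I by auto
  have "rt (insert i Y) j = reflection (rt Y i) (rt Y j)" "rt (insert i Y) i = rt Y i"
    using rt_insert_gt[OF iQ n(1) assms(4)] by (simp_all add: rt_insert_le)
  then have "reflection (rt Y i) (rt Y j) = - rt Y i"
    using assms(5) by (simp add: X)
  then have "reflection (rt Y i) (rt Y j) = reflection (rt Y i) (rt Y i)"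
    by (simp add: reflection_self)
  then have "rt Y i = rt Y j"
    by (metis reflection_reflection)
  then have ex: "red (insert j Y)" "subword_prod Q (insert j Y) = \<rho>"
    using red_exchange[OF red(1) n jQ] red(2) by simp_all
  have "{1..length Q} - insert i (I - {j}) = insert j Y"
    using jQ assms(2,3) by (auto simp: Y_def)
  then have "insert i (I - {j}) \<in> facets S Q \<rho>"
    using ex I iQ by (auto simp: facets_iff)
  moreover have "insert i (I - {j}) - {i} = I - {j}"
    using assms(3) by auto
  ultimately show ?thesis
    using assms(1,2,4) unfolding increasing_flip_graph_def by blast
qed

lemma source_greedy_from:
  assumes "I \<in> facets S Q \<rho>" "\<forall>J. (J, I) \<notin> increasing_flip_graph S Q \<rho>"
  shows "greedy_from 1 ({1..length Q} - I)"
proof -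
  let ?X = "{1..length Q} - I"
  have "rt ?X k \<in> pos_roots" if k: "k \<in> {1..length Q}" for k
  proof (rule ccontr)
    assume neg: "rt ?X k \<notin> pos_roots"
    then obtain j where j: "j \<in> ?X" "j < k" "rt ?X k = - rt ?X j"
      using rt_cases[OF k, of ?X] negative_rt_matched[OF k] by metis
    have "k \<in> I"
      using neg red_rt_pos[of ?X k] k assms(1) by (auto simp: facets_iff)
    then show False
      using increasing_flipI[OF assms(1) _ j] assms(2) by blast
  qed
  then show ?thesis
    by (simp add: greedy_from_1)
qed

text \<open>Shows that the definite description is meaningful: sources have only positive roots, and
  \<open>all_pos_unique\<close> allows at most one such facet.\<close>

lemma positive_greedy_facet:
  assumes "I \<in> facets S Q \<rho>"
  shows "positive_greedy_facet S Q \<rho> \<in> facets S Q \<rho>"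
    and "I = positive_greedy_facet S Q \<rho> \<longleftrightarrow> greedy_from 1 ({1..length Q} - I)"
proof -
  have unique: "J = K"
    if "J \<in> facets S Q \<rho>" "K \<in> facets S Q \<rho>"
      "greedy_from 1 ({1..length Q} - J)" "greedy_from 1 ({1..length Q} - K)" for J K
  proof -
    have "{1..length Q} - J = {1..length Q} - K"
      using that by (intro all_pos_unique) (auto simp: facets_iff greedy_from_1)
    then show ?thesis
      using that(1,2) unfolding facets_iff by blast
  qed
  \<comment> \<open>A facet of least sum has no incoming increasing flip, so a source
    exists.\<close>
  obtain K where K: "K \<in> facets S Q \<rho>" "\<forall>J. J \<in> facets S Q \<rho> \<longrightarrow> \<Sum>K \<le> \<Sum>J"
    using ex_has_least_nat[of "\<lambda>J. J \<in> facets S Q \<rho>" I "\<lambda>J. \<Sum>J"] assms by blast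
  have source: "\<forall>J. (J, K) \<notin> increasing_flip_graph S Q \<rho>"
  proof (intro allI notI)
    fix J assume J: "(J, K) \<in> increasing_flip_graph S Q \<rho>"
    then have "J \<in> facets S Q \<rho>"
      by (auto simp: increasing_flip_graph_def)
    then show False
      using K(2) increasing_flip_sum_less[OF J] by (meson leD)
  qed
  have "positive_greedy_facet S Q \<rho> = K"
    unfolding positive_greedy_facet_def
    by (rule the_equality) (use K(1) source source_greedy_from unique in blast)+
  then show "positive_greedy_facet S Q \<rho> \<in> facets S Q \<rho>"
    "I = positive_greedy_facet S Q \<rho> \<longleftrightarrow> greedy_from 1 ({1..length Q} - I)"
    using K(1) source_greedy_from[OF K(1) source] unique assms by blast+
qed

(* Both signs are read off in the suffix starting at the label i, where the root of i is simple. *)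
lemma increasing_flip_greedy_from:
  assumes "(J, I) \<in> increasing_flip_graph S Q \<rho>"
    and "greedy_from (p_label J I) ({1..length Q} - J)"
  shows "greedy_from (Suc (p_label J I)) ({1..length Q} - I)"
    and "\<not> greedy_from (p_label J I) ({1..length Q} - I)"
proof -
  obtain i j Y where lab: "p_label J I = i" and ij: "i < j"
    and Q: "i \<in> {1..length Q}" "j \<in> {1..length Q}" and n: "i \<notin> Y" "j \<notin> Y"
    and X: "{1..length Q} - J = insert j Y" "{1..length Q} - I = insert i Y"
    and red: "red (insert j Y)" and eq: "rt Y i = rt Y j"
    using assms(1) by (rule increasing_flipE) blast
  \<comment> \<open>In the suffix from \<open>i\<close>, the facet \<open>J\<close> uses
    \<open>insert j Z\<close> and \<open>I\<close> uses \<open>insert i Z\<close>; from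
    \<open>Suc i\<close> on, \<open>I\<close> uses just \<open>Z\<close>. The roots of
    \<open>Z\<close> at \<open>i\<close> and \<open>j\<close> are both the simple root
    \<beta>.\<close>
  define Z where "Z = Y \<inter> {i..}"
  define \<beta> where "\<beta> = \<alpha> (letter Q i)"
  have nZ: "i \<notin> Z" "j \<notin> Z"
    using n by (auto simp: Z_def)
  have s: "letter Q i = reflection \<beta>"
    unfolding \<beta>_def by (rule simple_reflection) (rule letter_in[OF Q(1)])
  have \<beta>: "\<beta> \<in> pos_roots"
    unfolding \<beta>_def by (rule simple_root_pos) (rule letter_in[OF Q(1)])
  have Zi: "rt Z i = \<beta>"
    by (simp add: Z_def \<beta>_def rt_start)
  then have Zj: "rt Z j = \<beta>"
    using rt_from_eq[of i i j Y] eq ij by (simp add: Z_def)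
  have ZJ: "insert j Y \<inter> {i..} = insert j Z" and ZI: "insert i Y \<inter> {i..} = insert i Z"
    and ZI': "insert i Y \<inter> {Suc i..} = Z"
    using ij n by (auto simp: Z_def Suc_le_eq le_less)
  have pos: "rt (insert j Z) k \<in> pos_roots" if "k \<in> {i..length Q}" for k
    using assms(2) that by (simp add: lab X greedy_from_def ZJ)
  have redZ: "red (insert j Z)"
    using red_from[OF red, of i] by (simp add: ZJ)
  have "rt Z k \<in> pos_roots" if k: "k \<in> {Suc i..length Q}" for k
  proof (cases "k \<le> j")
    case True
    then show ?thesis
      using pos[of k] k by (simp add: rt_insert_le)
  next
    case False
    then have v: "rt (insert j Z) k = letter Q i (rt Z k)"
      using rt_insert_gt[of j Z k] Q(2) nZ Zj s by simp
    have kQ: "k \<in> {1..length Q}"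
      using k by auto
    show ?thesis
    proof (rule ccontr)
      assume "rt Z k \<notin> pos_roots"
      then have neg: "- rt Z k \<in> pos_roots"
        using rt_cases[OF kQ] by blast
      have "rt Z k = letter Q i (rt (insert j Z) k)"
        unfolding v s by (simp add: reflection_reflection)
      moreover from this have "rt (insert j Z) k = \<beta>"
        unfolding \<beta>_def using pos[of k] k neg letter_in[OF Q(1)]
        by (intro pos_root_made_negative) auto
      ultimately have "rt Z k = - \<beta>"
        unfolding s by (simp add: reflection_self)
      moreover obtain l where l: "l \<in> Z" "l < k" "rt Z k = - rt Z l"
        using negative_rt_matched[OF kQ neg] by blast
      ultimately have Zl: "rt Z l = \<beta>"
        by simp
      have lQ: "l \<in> {i..length Q}"
        using l kQ by (auto simp: Z_def)
      \<comment> \<open>Before \<open>j\<close>, two used positions of a reduced subword would share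
        the root \<beta>; after \<open>j\<close>, the root at \<open>l\<close> would be negative
        although \<open>J\<close> is greedy from \<open>i\<close>.\<close>
      consider "l < j" | "j < l"
        using l(1) nZ(2) by (cases l j rule: linorder_cases) auto
      then show False
      proof cases
        case 1
        then have "rt (insert j Z) l = rt (insert j Z) j"
          using Zl Zj by (simp add: rt_insert_le)
        then show False
          using red_distinct(1)[OF redZ, of l j] l(1) 1 by simp
      next
        case 2
        then have "rt (insert j Z) l = - \<beta>"
          using rt_insert_gt[of j Z l] Q(2) nZ Zj Zl by (simp add: reflection_self)
        then show False
          using pos[OF lQ] \<beta> pos_root_not_neg by metis
      qed
    qed
  qed
  then show "greedy_from (Suc (p_label J I)) ({1..length Q} - I)"
    by (simp add: greedy_from_def lab X ZI')
  \<comment> \<open>Once \<open>i\<close> is used, its letter negates the root \<beta> at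
    \<open>j\<close>, which spoils greediness from \<open>i\<close>.\<close>
  have "rt (insert i Z) j = - \<beta>"
    using rt_insert_gt[of i Z j] Q(1) nZ Zi Zj ij by (simp add: reflection_self)
  then have "rt (insert i Z) j \<notin> pos_roots"
    using \<beta> pos_root_not_neg by metis
  moreover have "j \<in> {i..length Q}"
    using ij Q(2) by simp
  ultimately show "\<not> greedy_from (p_label J I) ({1..length Q} - I)"
    unfolding greedy_from_def lab X ZI by blast
qed

section \<open>The father of a facet\<close>

text \<open>Here \<open>y\<close> and \<open>x\<close> are expressed by roots of the complement of
  \<open>I\<close>; \<open>suffix_greedy_iff\<close> and \<open>root_function_eq_rt\<close> link
  them to suffix facets and root functions.\<close>

context
  fixes \<rho> :: "'v \<Rightarrow> 'v" and I :: "nat set" and y x :: nat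
  assumes I: "I \<in> facets S Q \<rho>" "I \<noteq> positive_greedy_facet S Q \<rho>"
    and y_def: "y = Max {y \<in> {1..length Q}. \<not> greedy_from y ({1..length Q} - I)}"
    and x_def: "x = Max {x \<in> I. rt ({1..length Q} - I) x = - rt ({1..length Q} - I) y}"
begin

text \<open>The set under \<open>Max\<close> contains 1 because \<open>I\<close> is not the greedy
  facet. Starts beyond the end of \<open>Q\<close> are vacuously greedy, so the last two claims hold
  without an upper bound on the start.\<close>

lemma y_props:
  shows "y \<in> {1..length Q}" "\<not> greedy_from y ({1..length Q} - I)"
    and "y < b \<Longrightarrow> greedy_from b ({1..length Q} - I)"
    and "1 \<le> a \<Longrightarrow> \<not> greedy_from a ({1..length Q} - I) \<Longrightarrow> a \<le> y"
proof -
  let ?B = "{y \<in> {1..length Q}. \<not> greedy_from y ({1..length Q} - I)}"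
  have "\<not> greedy_from 1 ({1..length Q} - I)"
    using positive_greedy_facet(2)[OF I(1)] I(2) by simp
  moreover from this have "1 \<le> length Q"
    by (auto simp: greedy_from_def)
  ultimately have "y \<in> ?B"
    unfolding y_def by (intro Max_in) auto
  then show y: "y \<in> {1..length Q}" "\<not> greedy_from y ({1..length Q} - I)"
    by auto
  show *: "a \<le> y" if "1 \<le> a" "\<not> greedy_from a ({1..length Q} - I)" for a
  proof -
    have "a \<in> ?B"
      using that by (auto simp: greedy_from_def)
    then show ?thesis
      unfolding y_def by (intro Max_ge) auto
  qed
  show "greedy_from b ({1..length Q} - I)" if "y < b" for b
    using *[of b] that y(1) by (cases "greedy_from b ({1..length Q} - I)") auto
qed

text \<open>Some root, at \<open>k\<close>, is negative in the suffix from \<open>y\<close> but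
  positive in the one from \<open>Suc y\<close>. So \<open>y\<close> is used and its letter changed
  the sign, which makes the roots at \<open>k\<close> and \<open>y\<close> opposite. Used positions
  have positive roots, hence \<open>k\<close> lies in \<open>I\<close> and the set under
  \<open>Max\<close> is nonempty.\<close>

lemma x_props:
  shows "y \<in> {1..length Q} - I" "x \<in> I" "y < x"
    and "rt ({1..length Q} - I) x = - rt ({1..length Q} - I) y"
    and "k \<in> I \<Longrightarrow> rt ({1..length Q} - I) k = - rt ({1..length Q} - I) y \<Longrightarrow> k \<le> x"
proof -
  let ?X = "{1..length Q} - I"
  let ?B = "{x \<in> I. rt ?X x = - rt ?X y}"
  have red: "red ?X" and IQ: "I \<subseteq> {1..length Q}"
    using I(1) by (simp_all add: facets_iff)
  have fin: "finite ?B"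
    using IQ finite_subset by fastforce
  obtain k where k: "k \<in> {y..length Q}" "rt (?X \<inter> {y..}) k \<notin> pos_roots"
    using y_props(2) by (auto simp: greedy_from_def)
  have kQ: "k \<in> {1..length Q}"
    using k(1) y_props(1) by auto
  have yS: "letter Q y \<in> S"
    using y_props(1) by (rule letter_in)
  have "k \<noteq> y"
    using k(2) simple_root_pos[OF yS] by (auto simp: rt_start)
  then have yk: "y < k"
    using k(1) by simp
  have pos: "rt (?X \<inter> {Suc y..}) k \<in> pos_roots"
    using y_props(3)[of "Suc y"] yk k(1) by (auto simp: greedy_from_def)
  have step: "rt (?X \<inter> {y..}) k
      = (if y \<in> ?X then letter Q y (rt (?X \<inter> {Suc y..}) k) else rt (?X \<inter> {Suc y..}) k)"
    by (rule rt_step[OF y_props(1) yk])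
  then show yX: "y \<in> ?X"
    using pos k(2) by metis
  have "- letter Q y (rt (?X \<inter> {Suc y..}) k) \<in> pos_roots"
    using step yX k(2) rt_cases[OF kQ, of "?X \<inter> {y..}"] by auto
  then have "rt (?X \<inter> {Suc y..}) k = \<alpha> (letter Q y)"
    by (rule pos_root_made_negative[OF pos yS])
  then have "rt (?X \<inter> {y..}) k = - rt (?X \<inter> {y..}) y"
    using step yX by (simp add: simple_apply_root[OF yS] rt_start)
  then have ky: "rt ?X k = - rt ?X y"
    using rt_from_eq_minus[of y k y ?X] yk by simp
  then have "rt ?X k \<notin> pos_roots"
    using red_rt_pos[OF red yX] pos_root_not_neg by metis
  then have "k \<in> I"
    using red_rt_pos[OF red, of k] kQ by blast
  then have kB: "k \<in> ?B"
    using ky by simp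
  then have "x \<in> ?B"
    unfolding x_def by (intro Max_in fin) blast
  then show "x \<in> I" "rt ?X x = - rt ?X y"
    by auto
  show max: "k \<le> x" if "k \<in> I" "rt ?X k = - rt ?X y" for k
    unfolding x_def by (rule Max_ge[OF fin]) (use that in simp)
  show "y < x"
    using max[of k] kB yk by simp
qed

lemma flip_edge: "(insert y (I - {x}), I) \<in> increasing_flip_graph S Q \<rho>"
  using increasing_flipI[OF I(1)] x_props by blast

lemma flip_p_label: "p_label (insert y (I - {x})) I = y"
  using x_props by (intro p_label_eq[where j = x]) auto

text \<open>Using \<open>x\<close> applies the letter at \<open>y\<close> to the positive roots
  after \<open>x\<close>. A root made negative was \<beta>, so in \<open>I\<close> its position
  carries the opposite of the root at \<open>y\<close>, against the maximality of
  \<open>x\<close>.\<close>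

lemma flip_greedy_from: "greedy_from y ({1..length Q} - insert y (I - {x}))"
  unfolding greedy_from_def
proof
  fix k assume k: "k \<in> {y..length Q}"
  let ?X = "{1..length Q} - I"
  define Z where "Z = ?X \<inter> {Suc y..}"
  have IQ: "I \<subseteq> {1..length Q}"
    using I(1) by (simp add: facets_iff)
  have "({1..length Q} - insert y (I - {x})) \<inter> {y..} = insert x Z"
    using x_props(1-3) IQ by (auto simp: Z_def Suc_le_eq le_less)
  moreover have "{1..length Q} - insert y (I - {x}) \<subseteq> {1..length Q}"
    by blast
  moreover have "red ({1..length Q} - insert y (I - {x}))"
    using flip_edge by (auto simp: increasing_flip_graph_def facets_iff)
  ultimately have XJ: "({1..length Q} - insert y (I - {x})) \<inter> {y..} = insert x Z"
    and red: "red (insert x Z)"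
    using red_from[of "{1..length Q} - insert y (I - {x})" y] by auto
  have xQ: "x \<in> {1..length Q}" and yQ: "y \<in> {1..length Q}" and xZ: "x \<notin> Z" and yZ: "y \<notin> Z"
    using x_props(1,2) IQ by (auto simp: Z_def)
  have XI: "?X \<inter> {y..} = insert y Z"
    using x_props(1) by (auto simp: Z_def Suc_le_eq le_less)
  have yS: "letter Q y \<in> S"
    using yQ by (rule letter_in)
  define \<beta> where "\<beta> = \<alpha> (letter Q y)"
  have s: "letter Q y = reflection \<beta>"
    unfolding \<beta>_def by (rule simple_reflection[OF yS])
  have "Z \<inter> {..<y} = {}"
    by (auto simp: Z_def)
  then have Zy: "rt Z y = \<beta>"
    by (simp add: \<beta>_def rt_def)
  have "rt (insert y Z) x = - rt (insert y Z) y"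
    using rt_from_eq_minus[of y x y ?X] x_props(3,4) by (simp add: XI)
  then have "reflection \<beta> (rt Z x) = - \<beta>"
    using rt_insert_gt[OF yQ yZ x_props(3)] Zy by (simp add: rt_insert_le)
  then have Zx: "rt Z x = \<beta>"
    by (metis reflection_reflection reflection_self)
  show "rt (({1..length Q} - insert y (I - {x})) \<inter> {y..}) k \<in> pos_roots"
    unfolding XJ
  proof (cases "k = y")
    case True
    then show "rt (insert x Z) k \<in> pos_roots"
      using Zy simple_root_pos[OF yS] x_props(3) by (simp add: rt_insert_le \<beta>_def)
  next
    case False
    then have yk: "y < k"
      using k by simp
    have kQ: "k \<in> {1..length Q}"
      using yk k by simp
    have u: "rt Z k \<in> pos_roots"
      using y_props(3)[of "Suc y"] yk k by (simp add: greedy_from_def Z_def)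
    show "rt (insert x Z) k \<in> pos_roots"
    proof (cases "k \<le> x")
      case True
      then show ?thesis
        using u by (simp add: rt_insert_le)
    next
      case False
      then have v: "rt (insert x Z) k = letter Q y (rt Z k)"
        using rt_insert_gt[OF xQ xZ, of k] Zx s by simp
      show ?thesis
      proof (rule ccontr)
        assume neg: "rt (insert x Z) k \<notin> pos_roots"
        then have "- letter Q y (rt Z k) \<in> pos_roots"
          using rt_cases[OF kQ, of "insert x Z"] v by auto
        then have "rt Z k = \<beta>"
          unfolding \<beta>_def by (rule pos_root_made_negative[OF u yS])
        then have "rt (insert y Z) k = - rt (insert y Z) y"
          using rt_insert_gt[OF yQ yZ yk] Zy by (simp add: rt_insert_le reflection_self)
        then have "rt ?X k = - rt ?X y"
          using rt_from_eq_minus[of y k y ?X] yk by (simp add: XI)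
        moreover have "k \<in> I"
          using red_rt_pos[OF red, of k] neg yk kQ by (auto simp: Z_def)
        ultimately show False
          using x_props(5) False by blast
      qed
    qed
  qed
qed

lemma greedy_flip_unique:
  assumes "(J, I) \<in> increasing_flip_graph S Q \<rho>"
    and "greedy_from (p_label J I) ({1..length Q} - J)"
  shows "J = insert y (I - {x})"
proof -
  let ?X = "{1..length Q} - I"
  obtain i j Y where J: "J = insert i (I - {j})" and jI: "j \<in> I"
    and lab: "p_label J I = i" and ij: "i < j"
    and Q: "i \<in> {1..length Q}" "j \<in> {1..length Q}" and n: "i \<notin> Y" "j \<notin> Y"
    and X: "{1..length Q} - J = insert j Y" "?X = insert i Y"
    and eq: "rt Y i = rt Y j"
    using assms(1) by (rule increasing_flipE) blast
  have "greedy_from (Suc i) ?X" "\<not> greedy_from i ?X"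
    using increasing_flip_greedy_from[OF assms] by (simp_all add: lab)
  \<comment> \<open>\<open>i\<close> is at most \<open>y\<close> as \<open>I\<close> is not greedy
    from \<open>i\<close>; were it smaller, greediness from \<open>Suc i\<close> would pass to
    \<open>y\<close>.\<close>
  then have iy: "i = y"
    using y_props(2) y_props(4)[of i] greedy_from_mono[of "Suc i" ?X y] Q(1)
    by (cases "i < y") auto
  have "rt ?X j = - rt ?X y"
    using rt_insert_gt[OF Q(1) n(1) ij] eq by (simp add: X(2) iy rt_insert_le reflection_self)
  then have "j \<le> x"
    using x_props(5) jI by blast
  moreover have "\<not> j < x"
  proof
    assume jx: "j < x"
    have "reflection (rt Y y) (rt Y x) = - rt Y y"
      using rt_insert_gt[OF Q(1) n(1), of x] x_props(3,4) by (simp add: X(2) iy rt_insert_le)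
    \<comment> \<open>Without \<open>y\<close> and \<open>j\<close>, the positions \<open>y\<close>,
      \<open>j\<close> and \<open>x\<close> share one root; using \<open>j\<close> negates the root
      at \<open>x\<close>.\<close>
    then have "rt Y x = rt Y j"
      using eq unfolding iy by (metis reflection_reflection reflection_self)
    then have "rt (insert j Y) x = - rt (insert j Y) y"
      using rt_insert_gt[OF Q(2) n(2) jx] eq ij
      by (simp add: iy rt_insert_le reflection_self)
    then have "rt (insert j Y \<inter> {y..}) x = - rt (insert j Y \<inter> {y..}) y"
      using rt_from_eq_minus[of y x y "insert j Y"] x_props(3) by simp
    moreover have "x \<in> {y..length Q}" "y \<in> {y..length Q}"
      using x_props(1-3) I(1) by (auto simp: facets_iff)
    ultimately show False
      using assms(2) pos_root_not_neg unfolding lab X iy greedy_from_def by metis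
  qed
  ultimately show ?thesis
    using J iy by simp
qed

end

section \<open>Rising paths from the greedy facet\<close>

abbreviation p_labels :: "nat set list \<Rightarrow> nat list" where
  "p_labels Is \<equiv> map2 p_label Is (tl Is)"

lemma p_labels_snoc: "p_labels (Is @ [J, I]) = p_labels (Is @ [J]) @ [p_label J I]"
proof (induction Is)
  case (Cons K Is)
  then show ?case
    by (cases Is) simp_all
qed simp

lemma p_rising_path_snoc:
  "p_rising_path S Q \<rho> (Is @ [J, I]) \<longleftrightarrow> p_rising_path S Q \<rho> (Is @ [J])
    \<and> (J, I) \<in> increasing_flip_graph S Q \<rho> \<and> (\<forall>l\<in>set (p_labels (Is @ [J])). l < p_label J I)"
  unfolding p_rising_path_def p_labels_snoc
  by (auto simp: successively_append_iff sorted_wrt_append increasing_flip_graph_def)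

lemma positive_source_paths_snoc:
  "Is @ [J, I] \<in> positive_source_paths S Q \<rho> \<longleftrightarrow> Is @ [J] \<in> positive_source_paths S Q \<rho>
    \<and> (J, I) \<in> increasing_flip_graph S Q \<rho> \<and> (\<forall>l\<in>set (p_labels (Is @ [J])). l < p_label J I)"
proof -
  have "hd (Is @ [J, I]) = hd (Is @ [J])"
    by (cases Is) simp_all
  then show ?thesis
    by (auto simp: positive_source_paths_def p_rising_path_snoc)
qed

text \<open>The first facet is greedy from 1. An edge with label \<open>l\<close> leaves its target
  greedy from \<open>Suc l\<close>, and the next label is at least that.\<close>

lemma last_label_greedy_from:
  assumes "Is @ [J, I] \<in> positive_source_paths S Q \<rho>"
  shows "greedy_from (p_label J I) ({1..length Q} - J)"
  using assms
proof (induction Is arbitrary: J I rule: rev_induct)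
  case Nil
  then have "J = positive_greedy_facet S Q \<rho>" and J: "(J, I) \<in> increasing_flip_graph S Q \<rho>"
    by (auto simp: positive_source_paths_def p_rising_path_def)
  then have "greedy_from 1 ({1..length Q} - J)"
    using positive_greedy_facet(2)[of J \<rho>] by (auto simp: increasing_flip_graph_def)
  moreover have "1 \<le> p_label J I"
    using J by (rule increasing_flipE) simp
  ultimately show ?case
    using greedy_from_mono by blast
next
  case (snoc K Is)
  then have path: "Is @ [K, J] \<in> positive_source_paths S Q \<rho>"
    and less: "\<forall>l\<in>set (p_labels (Is @ [K, J])). l < p_label J I"
    using positive_source_paths_snoc[of "Is @ [K]" J I \<rho>] by simp_all
  have edge: "(K, J) \<in> increasing_flip_graph S Q \<rho>"
    using path positive_source_paths_snoc by blast
  have "greedy_from (Suc (p_label K J)) ({1..length Q} - J)"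
    using increasing_flip_greedy_from(1)[OF edge snoc.IH[OF path]] .
  moreover have "p_label K J < p_label J I"
    using less unfolding p_labels_snoc by simp
  ultimately show ?case
    using greedy_from_mono[of "Suc (p_label K J)"] by simp
qed

text \<open>The bound \<open>n\<close> on the labels strengthens the induction: the path to the
  flipped facet has labels below \<open>y\<close>, so the edge with label \<open>y\<close> can be
  appended. Here \<open>y < n\<close>, as greediness from \<open>n\<close> passes to later
  starts.\<close>

lemma positive_source_path_exists:
  assumes "I \<in> facets S Q \<rho>" "1 \<le> n" "greedy_from n ({1..length Q} - I)"
  shows "\<exists>Is. Is @ [I] \<in> positive_source_paths S Q \<rho> \<and> (\<forall>l\<in>set (p_labels (Is @ [I])). l < n)"
  using assms
proof (induction "\<Sum>I" arbitrary: I n rule: less_induct)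
  case less
  show ?case
  proof (cases "I = positive_greedy_facet S Q \<rho>")
    case True
    then have "[] @ [I] \<in> positive_source_paths S Q \<rho>"
      using less.prems(1) by (simp add: positive_source_paths_def p_rising_path_def)
    then show ?thesis
      by fastforce
  next
    case False
    define y where "y = Max {y \<in> {1..length Q}. \<not> greedy_from y ({1..length Q} - I)}"
    define x where "x = Max {x \<in> I. rt ({1..length Q} - I) x = - rt ({1..length Q} - I) y}"
    define J where "J = insert y (I - {x})"
    note facts = less.prems(1) False y_def x_def
    have edge: "(J, I) \<in> increasing_flip_graph S Q \<rho>" and label: "p_label J I = y"
      and greedy: "greedy_from y ({1..length Q} - J)"
      unfolding J_def using flip_edge[OF facts] flip_p_label[OF facts] flip_greedy_from[OF facts] .
    have y: "1 \<le> y" "\<not> greedy_from y ({1..length Q} - I)"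
      using y_props[OF less.prems(1) False y_def] by simp_all
    obtain Is where Is: "Is @ [J] \<in> positive_source_paths S Q \<rho>"
      "\<forall>l\<in>set (p_labels (Is @ [J])). l < y"
      using less.hyps[OF increasing_flip_sum_less[OF edge] _ y(1) greedy] edge
      by (auto simp: increasing_flip_graph_def)
    have path: "Is @ [J, I] \<in> positive_source_paths S Q \<rho>"
      using Is edge label by (simp add: positive_source_paths_snoc)
    have "y < n"
      using y(2) less.prems(2,3) greedy_from_mono[of n _ y] by (meson not_le)
    then have "\<forall>l\<in>set (p_labels (Is @ [J, I])). l < n"
      using Is(2) label unfolding p_labels_snoc by auto
    then show ?thesis
      using path by (intro exI[of _ "Is @ [J]"]) simp
  qed
qed

text \<open>The description in \<open>father\<close> is unambiguous: a rising path through the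
  flipped facet exists, and the last edge of any rising path to \<open>I\<close> starts there by
  \<open>greedy_flip_unique\<close>.\<close>

lemma father_eq_flip:
  assumes "I \<in> facets S Q \<rho>" "I \<noteq> positive_greedy_facet S Q \<rho>"
    and "y = Max {y \<in> {1..length Q}. \<not> greedy_from y ({1..length Q} - I)}"
    and "x = Max {x \<in> I. rt ({1..length Q} - I) x = - rt ({1..length Q} - I) y}"
  shows "father S Q \<rho> I = insert y (I - {x})"
    and "(father S Q \<rho> I, I) \<in> positive_source_tree S Q \<rho>"
    and "is_flip S Q \<rho> I x (father S Q \<rho> I)"
proof -
  define J where "J = insert y (I - {x})"
  have edge: "(J, I) \<in> increasing_flip_graph S Q \<rho>" and label: "p_label J I = y"
    and greedy: "greedy_from y ({1..length Q} - J)"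
    unfolding J_def using flip_edge[OF assms] flip_p_label[OF assms] flip_greedy_from[OF assms] .
  have fac: "J \<in> facets S Q \<rho>"
    using edge by (simp add: increasing_flip_graph_def)
  have "1 \<le> y"
    using y_props(1)[OF assms(1-3)] by simp
  from positive_source_path_exists[OF fac this greedy] obtain Is
    where "Is @ [J] \<in> positive_source_paths S Q \<rho>" "\<forall>l\<in>set (p_labels (Is @ [J])). l < y"
    by blast
  then have path: "Is @ [J, I] \<in> positive_source_paths S Q \<rho>"
    using edge label by (simp add: positive_source_paths_snoc)
  have father: "father S Q \<rho> I = J"
    unfolding father_def
  proof (rule the_equality)
    fix K assume "\<exists>Is. Is @ [K, I] \<in> positive_source_paths S Q \<rho>"
    then obtain Ks where "Ks @ [K, I] \<in> positive_source_paths S Q \<rho>" ..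
    then show "K = J"
      unfolding J_def using greedy_flip_unique[OF assms] last_label_greedy_from
        positive_source_paths_snoc by blast
  qed (use path in blast)
  show "father S Q \<rho> I = insert y (I - {x})"
    using father by (simp add: J_def)
  have "(J, I) \<in> set (zip (Is @ [J, I]) (tl (Is @ [J, I])))"
  proof (induction Is)
    case (Cons K Is)
    then show ?case
      by (cases Is) simp_all
  qed simp
  then show "(father S Q \<rho> I, I) \<in> positive_source_tree S Q \<rho>"
    unfolding father positive_source_tree_def using path by blast
  have "I - {x} = J - {y}" "I \<noteq> J" "y \<in> J" "x \<in> I"
    using x_props[OF assms] by (auto simp: J_def)
  then show "is_flip S Q \<rho> I x (father S Q \<rho> I)"
    unfolding father is_flip_def using assms(1) fac by blast
qed

text \<open>The suffix is a Coxeter word in its own right, so the root criterion for the greedy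
  facet applies to it; it remains to renumber positions.\<close>

lemma suffix_greedy_iff:
  assumes "I \<in> facets S Q \<rho>" "y \<in> {1..length Q}"
  shows "{i - y + 1 | i. i \<in> I \<and> i \<ge> y}
      = positive_greedy_facet S (drop (y - 1) Q) (subword_prod Q ({y..length Q} - I))
    \<longleftrightarrow> greedy_from y ({1..length Q} - I)"
proof -
  let ?X = "{1..length Q} - I"
  \<comment> \<open>Position \<open>k\<close> of the suffix is position \<open>n + k\<close> of
    \<open>Q\<close>; for \<open>i \<ge> y\<close>, the number \<open>i - y + 1\<close> is
    \<open>i - n\<close>.\<close>
  define n where "n = y - 1"
  define K where "K = {i - y + 1 | i. i \<in> I \<and> i \<ge> y}"
  have n: "y = Suc n"
    using assms(2) by (auto simp: n_def)
  have "drop n Q \<in> lists S"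
    using Q_letters set_drop_subset[of n Q] by (auto simp: in_lists_conv_set)
  then have "coxeter_word W S \<Phi> \<alpha> (drop n Q)"
    by (intro coxeter_word.intro coxeter_word_axioms.intro finite_coxeter_system_axioms)
  then interpret drop: coxeter_word W S \<Phi> \<alpha> "drop n Q" .
  have IQ: "I \<subseteq> {1..length Q}" and red: "red ?X"
    using assms(1) by (simp_all add: facets_iff)
  have XI: "{y..length Q} - I = ?X \<inter> {y..}"
    using assms(2) by auto
  have memK: "k \<in> K \<longleftrightarrow> 1 \<le> k \<and> n + k \<in> I" for k
  proof
    assume "1 \<le> k \<and> n + k \<in> I"
    then show "k \<in> K"
      unfolding K_def n by (intro CollectI exI[of _ "n + k"]) auto
  qed (auto simp: K_def n)
  define X' where "X' = {1..length (drop n Q)} - K"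
  have memX': "k \<in> X' \<longleftrightarrow> n + k \<in> ?X \<inter> {y..}" for k
    using memK[of k] by (auto simp: X'_def n)
  have sub: "?X \<inter> {y..} \<inter> A \<subseteq> {n<..}" for A
    by (auto simp: n)
  have "X' = {k. n + k \<in> ?X \<inter> {y..}}"
    using memX' by blast
  then have shift: "subword (drop n Q) X' = subword Q (?X \<inter> {y..})"
    using subword_drop[OF sub[of UNIV], of Q] by simp
  have "X' \<inter> {..<k} = {j. n + j \<in> ?X \<inter> {y..} \<inter> {..<n + k}}" for k
    using memX' by auto
  then have shift_less: "subword (drop n Q) (X' \<inter> {..<k}) = subword Q (?X \<inter> {y..} \<inter> {..<n + k})" for k
    using subword_drop[OF sub[of "{..<n + k}"], of Q] by simp
  have "length (subword (drop n Q) X') = card X'" "length (subword Q (?X \<inter> {y..})) = card (?X \<inter> {y..})"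
    by (rule length_subword, force simp: X'_def)+
  then have card: "card X' = card (?X \<inter> {y..})"
    by (simp add: shift)
  \<comment> \<open>The used positions from \<open>y\<close> on form a reduced subword by
    \<open>red_from\<close>, and renumbering preserves both their product and their number.\<close>
  have K: "K \<in> facets S (drop n Q) (subword_prod Q (?X \<inter> {y..}))"
    unfolding drop.facets_iff
  proof (intro conjI)
    show "K \<subseteq> {1..length (drop n Q)}"
    proof
      fix k assume "k \<in> K"
      then have "1 \<le> k" "n + k \<le> length Q"
        using memK IQ by auto
      then show "k \<in> {1..length (drop n Q)}"
        by simp
    qed
    show *: "subword_prod (drop n Q) ({1..length (drop n Q)} - K) = subword_prod Q (?X \<inter> {y..})"
      unfolding X'_def[symmetric] subword_prod_def shift ..
    show "drop.red ({1..length (drop n Q)} - K)"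
      using red_from[OF red, of y] card * unfolding drop.red_def red_def X'_def[symmetric]
      by (auto simp: X'_def)
  qed
  have rt: "drop.rt X' k = rt (?X \<inter> {y..}) (n + k)" if "k \<in> {1..length (drop n Q)}" for k
  proof -
    have "letter (drop n Q) k = letter Q (n + k)"
      using that by (auto simp: letter_def)
    then show ?thesis
      by (simp add: drop.rt_def rt_def subword_prod_def shift_less)
  qed
  have "drop.greedy_from 1 X' \<longleftrightarrow> (\<forall>k\<in>{1..length (drop n Q)}. drop.rt X' k \<in> pos_roots)"
    by (rule drop.greedy_from_1) (auto simp: X'_def)
  also have "\<dots> \<longleftrightarrow> (\<forall>k\<in>{1..length (drop n Q)}. rt (?X \<inter> {y..}) (n + k) \<in> pos_roots)"
    by (intro ball_cong refl) (simp only: rt)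
  also have "\<dots> \<longleftrightarrow> greedy_from y ?X"
  proof
    assume *: "\<forall>k\<in>{1..length (drop n Q)}. rt (?X \<inter> {y..}) (n + k) \<in> pos_roots"
    show "greedy_from y ?X"
      unfolding greedy_from_def
    proof
      fix k assume k: "k \<in> {y..length Q}"
      then have "k - n \<in> {1..length (drop n Q)}"
        by (auto simp: n One_nat_def)
      then show "rt (?X \<inter> {y..}) k \<in> pos_roots"
        using bspec[OF *, of "k - n"] k by (simp add: n)
    qed
  qed (auto simp: greedy_from_def n)
  finally show ?thesis
    using drop.positive_greedy_facet(2)[OF K]
    unfolding X'_def[symmetric] K_def[symmetric] XI n_def[symmetric] by simp
qed

end

theorem proposition4p20:
  fixes W S :: "('v::euclidean_space \<Rightarrow> 'v) set"
    and \<Phi> :: "'v set"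
    and \<alpha> :: "('v \<Rightarrow> 'v) \<Rightarrow> 'v"
    and Q :: "('v \<Rightarrow> 'v) list"
    and \<rho> :: "'v \<Rightarrow> 'v"
    and I :: "nat set"
    and x y :: nat
  assumes "finite_coxeter_system W S \<Phi> \<alpha>"
    and "Q \<in> lists S"
    and "\<rho> \<in> W"
    and "I \<in> facets S Q \<rho>"
    and "I \<noteq> positive_greedy_facet S Q \<rho>"
    and "y = Max {y \<in> {1..length Q}.
               {i - y + 1 | i. i \<in> I \<and> i \<ge> y} \<noteq>
               positive_greedy_facet S (drop (y - 1) Q) (subword_prod Q ({y..length Q} - I))}"
    and "x = Max {x \<in> I. root_function \<alpha> Q I x = - root_function \<alpha> Q I y}"
  shows "(father S Q \<rho> I, I) \<in> positive_source_tree S Q \<rho> \<and>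
         is_flip S Q \<rho> I x (father S Q \<rho> I)"
proof -
  interpret coxeter_word W S \<Phi> \<alpha> Q
    using assms(1,2) by (simp add: coxeter_word_def coxeter_word_axioms_def)
  let ?X = "{1..length Q} - I"
  have y: "y = Max {y \<in> {1..length Q}. \<not> greedy_from y ?X}"
    unfolding assms(6) using suffix_greedy_iff[OF assms(4)]
    by (intro arg_cong[where f = Max] Collect_cong) blast
  \<comment> \<open>Rewriting the root function at \<open>y\<close> and at elements of
    \<open>I\<close> requires them to be positions of \<open>Q\<close>.\<close>
  have "y \<in> {1..length Q}" "I \<subseteq> {1..length Q}"
    using y_props(1)[OF assms(4,5) y] assms(4) by (simp_all add: facets_iff)
  then have "x = Max {x \<in> I. rt ?X x = - rt ?X y}"
    unfolding assms(7)
    by (intro arg_cong[where f = Max] Collect_cong conj_cong refl)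
      (simp add: root_function_eq_rt subset_eq)
  then show ?thesis
    using father_eq_flip(2,3)[OF assms(4,5) y] by blast
qed

end
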